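(* For any partition $G=A_1\cup\dots\cup A_n$ of a group $G$ there is a cell $A_i$ of the partition such that the set $(A_iA_i^{-1})^{4^{n-1}}$ is a subgroup of index $\le n$ in $G$.
   Context: For a subset $A$ of a group $G$, $A^{-1}=\{a^{-1}:a\in A\}$, $AB=\{ab:a\in A,b\in B\}$, and powers are setwise products: $A^1=A$ and $A^{k+1}=\{xy:x\in A^k,\ y\in A\}$ for $k\in\mathbb N$. *)

theory Defs
  imports "HOL-Algebra.Coset" "HOL-Library.Disjoint_Sets"
begin

(* Powers start at k = 1, with A^1 = A and A^(k+1) = A^k A; the value at k = 0 only totalises
   the function. *)
fun set_power :: "('a, 'b) monoid_scheme \<Rightarrow> 'a set \<Rightarrow> nat \<Rightarrow> 'a set" where
  "set_power G A 0 = {\<one>\<^bsub>G\<^esub>}"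
| "set_power G A (Suc 0) = A"
| "set_power G A (Suc (Suc k)) = set_power G A (Suc k) <#>\<^bsub>G\<^esub> A"

(* Finiteness is explicit because card of an infinite set is 0. *)
definition subgroup_of_index_le :: "('a, 'b) monoid_scheme \<Rightarrow> 'a set \<Rightarrow> nat \<Rightarrow> bool" where
  "subgroup_of_index_le G H n \<longleftrightarrow>
     subgroup H G \<and> finite (rcosets\<^bsub>G\<^esub> H) \<and> card (rcosets\<^bsub>G\<^esub> H) \<le> n"

end

(* A finitely additive mean mu acts on bounded functions by (T_mu f)(z) = mu(x |-> f(z x)). By
   compactness there is a mean mu such that sup |T_sigma T_mu f| is never smaller than
   sup |T_mu f|; Cesaro averages then force T_mu T_sigma T_mu = T_mu for every mean sigma (Hamana's
   argument for minimal seminorms). Choose a cell A with mu(A) >= 1/n and put h = T_mu 1_A,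
   m = sup h. If h(a y) <= 1/(n+1) for all a in A, applying this identity to the translation sigma
   by y gives h <= m - e h with e = m - 1/(n+1) > 0, which is impossible. So every y has some a in A
   with a y in W = {h > 1/(n+1)}. The sets inv(w) A, w in W, have mean > 1/(n+1), so at most n of
   them are disjoint; with B = A inv(A) this yields W <= B E and G = B^2 E with card E <= n.

   Elements of B^(5j) - B^(5j-1) for j = 0..n cannot lie in distinct translates B^2 e, so the powers of
   B stabilise from exponent 5n - 1 on, which is at most 4^(n-1) for n >= 3. For n = 2, if B is not
   all of G for the first cell, then two translates of the second cell cover G. *)
theory Submission
  imports Defs "HOL-Analysis.Function_Topology" "HOL-Analysis.Elementary_Normed_Spaces"
begin

subsection \<open>Means and their convolution\<close>

text \<open>Unbounded functions get the junk value 0, so that the set of means is compact in the product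
  topology.\<close>

definition means :: "'x set \<Rightarrow> (('x \<Rightarrow> real) \<Rightarrow> real) set" where
  "means X = {\<mu>. \<mu> (\<lambda>_. 1) = 1
     \<and> (\<forall>f g. bounded (f ` X) \<longrightarrow> bounded (g ` X) \<longrightarrow> \<mu> (\<lambda>x. f x + g x) = \<mu> f + \<mu> g)
     \<and> (\<forall>c f. bounded (f ` X) \<longrightarrow> \<mu> (\<lambda>x. c * f x) = c * \<mu> f)
     \<and> (\<forall>f. bounded (f ` X) \<longrightarrow> (\<forall>x\<in>X. 0 \<le> f x) \<longrightarrow> 0 \<le> \<mu> f)
     \<and> (\<forall>f. \<not> bounded (f ` X) \<longrightarrow> \<mu> f = 0)}"

lemma bounded_image_real_iff:
  fixes f :: "'x \<Rightarrow> real"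
  shows "bounded (f ` X) \<longleftrightarrow> (\<exists>c. \<forall>x\<in>X. \<bar>f x\<bar> \<le> c)"
  by (auto simp: bounded_iff)

lemma bounded_image_mult:
  fixes f :: "'x \<Rightarrow> real"
  assumes "bounded (f ` X)"
  shows "bounded ((\<lambda>x. c * f x) ` X)"
  using bounded_scaleR_comp[OF assms, of c] by simp

lemma bounded_image_sum:
  fixes f :: "'i \<Rightarrow> 'x \<Rightarrow> real"
  assumes "\<And>i. i \<in> I \<Longrightarrow> bounded (f i ` X)"
  shows "bounded ((\<lambda>x. \<Sum>i\<in>I. f i x) ` X)"
  using assms
proof (induction I rule: infinite_finite_induct)
  case (insert i I)
  then show ?case using bounded_plus_comp[of "f i" X "\<lambda>x. \<Sum>i\<in>I. f i x"] by simp
qed (auto simp: bounded_image_real_iff)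

lemma bounded_image_indicator: "bounded ((indicator A :: 'x \<Rightarrow> real) ` X)"
  by (auto simp: bounded_image_real_iff indicator_def intro!: exI[of _ 1])

context
  fixes X :: "'x set" and \<mu>
  assumes \<mu>: "\<mu> \<in> means X"
begin

lemma mean_const: "\<mu> (\<lambda>_. c) = c"
proof -
  have "bounded ((\<lambda>_::'x. 1::real) ` X)" by (auto simp: bounded_image_real_iff)
  then have "\<mu> (\<lambda>x. c * 1) = c * \<mu> (\<lambda>_. 1)" using \<mu> unfolding means_def by blast
  then show ?thesis using \<mu> by (simp add: means_def)
qed

lemma mean_add:
  "\<lbrakk>bounded (f ` X); bounded (g ` X)\<rbrakk> \<Longrightarrow> \<mu> (\<lambda>x. f x + g x) = \<mu> f + \<mu> g"
  using \<mu> by (simp add: means_def)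

lemma mean_mult: "bounded (f ` X) \<Longrightarrow> \<mu> (\<lambda>x. c * f x) = c * \<mu> f"
  using \<mu> by (simp add: means_def)

lemma mean_diff:
  assumes "bounded (f ` X)" "bounded (g ` X)"
  shows "\<mu> (\<lambda>x. f x - g x) = \<mu> f - \<mu> g"
  using mean_add[OF assms(1) bounded_image_mult[OF assms(2), of "-1"]] mean_mult[OF assms(2), of "-1"]
  by simp

lemma mean_mono:
  assumes "bounded (f ` X)" "bounded (g ` X)" "\<And>x. x \<in> X \<Longrightarrow> f x \<le> g x"
  shows "\<mu> f \<le> \<mu> g"
proof -
  have "0 \<le> \<mu> (\<lambda>x. g x - f x)"
    using \<mu> assms bounded_minus_comp[OF assms(2,1)] by (simp add: means_def)
  then show ?thesis using mean_diff[OF assms(2,1)] by simp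
qed

lemma mean_cong:
  assumes "\<And>x. x \<in> X \<Longrightarrow> f x = g x"
  shows "\<mu> f = \<mu> g"
proof (cases "bounded (f ` X)")
  case True
  moreover have "f ` X = g ` X" using assms by auto
  ultimately have "bounded (g ` X)" by simp
  with True show ?thesis using assms mean_mono[of f g] mean_mono[of g f] by force
next
  case False
  moreover have "f ` X = g ` X" using assms by auto
  ultimately show ?thesis using \<mu> by (simp add: means_def)
qed

lemma mean_abs_le:
  assumes "\<And>x. x \<in> X \<Longrightarrow> \<bar>f x\<bar> \<le> c"
  shows "\<bar>\<mu> f\<bar> \<le> c"
proof -
  have f: "bounded (f ` X)" using assms by (auto simp: bounded_image_real_iff)
  have c: "bounded ((\<lambda>_. d) ` X)" for d :: real by (auto simp: bounded_image_real_iff)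
  have "\<mu> f \<le> c" using mean_mono[OF f c[of c]] assms mean_const by force
  moreover have "-c \<le> \<mu> f" using mean_mono[OF c[of "-c"] f] assms mean_const by force
  ultimately show ?thesis by simp
qed

lemma mean_sum:
  assumes "\<And>i. i \<in> I \<Longrightarrow> bounded (f i ` X)"
  shows "\<mu> (\<lambda>x. \<Sum>i\<in>I. f i x) = (\<Sum>i\<in>I. \<mu> (f i))"
  using assms
proof (induction I rule: infinite_finite_induct)
  case (insert i I)
  then show ?case
    using mean_add[of "f i" "\<lambda>x. \<Sum>i\<in>I. f i x"] bounded_image_sum[of I f X] by simp
qed (auto simp: mean_const)

end

section \<open>Compactness of the set of means, and minimal closed invariant sets\<close>

lemma closed_means: "closed (means X)"
  unfolding means_def
  by (intro closed_Collect_conj closed_Collect_all closed_Collect_imp closed_Collect_eq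
      closed_Collect_le open_Collect_const continuous_intros continuous_on_product_coordinates)

text \<open>Tychonoff: a mean sends a bounded \<open>f\<close> into a fixed compact interval and
  every other function to 0, so the means form a closed subset of a product of compact sets.\<close>

lemma compact_means: "compact (means X)"
proof -
  define b where "b f = (SOME c. bounded (f ` X) \<longrightarrow> (\<forall>x\<in>X. \<bar>f x\<bar> \<le> c))" for f :: "'a \<Rightarrow> real"
  have b: "\<bar>f x\<bar> \<le> b f" if "bounded (f ` X)" "x \<in> X" for f x
    using that someI_ex[of "\<lambda>c. bounded (f ` X) \<longrightarrow> (\<forall>x\<in>X. \<bar>f x\<bar> \<le> c)"]
    unfolding b_def bounded_image_real_iff by blast
  define K where "K = (\<Pi>\<^sub>E f\<in>UNIV. if bounded (f ` X) then {- b f..b f} else {0})"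
  have "compactin (product_topology (\<lambda>_. euclidean) UNIV) K"
    unfolding K_def compactin_PiE by auto
  then have K: "compact K" by (simp add: euclidean_product_topology)
  have sub: "means X \<subseteq> K"
  proof
    fix \<mu> assume \<mu>: "\<mu> \<in> means X"
    have "\<mu> f \<in> (if bounded (f ` X) then {- b f..b f} else {0})" for f
      using mean_abs_le[OF \<mu>, of f "b f"] b[of f] \<mu> by (auto simp: means_def abs_le_iff)
    then show "\<mu> \<in> K" by (auto simp: K_def)
  qed
  show ?thesis using K sub closed_means[of X] by (metis compact_Int_closed inf.absorb2)
qed

text \<open>Zorn's lemma for reversed inclusion; compactness of \<open>S\<close> keeps the
  intersection of a chain nonempty.\<close>

lemma minimal_invariant_closed_subset:
  fixes S :: "'x::topological_space set"
  assumes "compact S" "closed S" "S \<noteq> {}" and "\<And>h. h \<in> F \<Longrightarrow> h ` S \<subseteq> S"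
  obtains L where "closed L" "L \<noteq> {}" "L \<subseteq> S" "\<And>h. h \<in> F \<Longrightarrow> h ` L \<subseteq> L"
    and "\<And>K. \<lbrakk>closed K; K \<noteq> {}; K \<subseteq> L; \<And>h. h \<in> F \<Longrightarrow> h ` K \<subseteq> K\<rbrakk> \<Longrightarrow> K = L"
proof -
  \<comment> \<open>Passing to complements turns the wanted minimal sets into the maximal sets that
    Zorn's lemma provides; unions of chains then encode intersections.\<close>
  define \<A> where
    "\<A> = {U. closed (- U) \<and> - U \<noteq> {} \<and> - U \<subseteq> S \<and> (\<forall>h\<in>F. h ` (- U) \<subseteq> - U)}"
  have "\<exists>M\<in>\<A>. \<forall>U\<in>\<A>. M \<subseteq> U \<longrightarrow> U = M"
  proof (rule subset_Zorn_nonempty)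
    have "- S \<in> \<A>" using assms by (simp add: \<A>_def)
    then show "\<A> \<noteq> {}" by blast
  next
    fix \<C> assume ne: "\<C> \<noteq> {}" and ch: "subset.chain \<A> \<C>"
    then have sub: "\<C> \<subseteq> \<A>" and lin: "\<And>U V. \<lbrakk>U \<in> \<C>; V \<in> \<C>\<rbrakk> \<Longrightarrow> U \<subseteq> V \<or> V \<subseteq> U"
      by (auto simp: subset_chain_def)
    \<comment> \<open>By the finite intersection property only finite subfamilies matter. A nonempty
      finite chain contains its own union, so the intersection of the complements is one of them,
      hence nonempty.\<close>
    have "S \<inter> \<Inter>(uminus ` \<C>) \<noteq> {}"
    proof (rule compact_imp_fip[OF assms(1)])
      show "closed T" if "T \<in> uminus ` \<C>" for T using that sub by (auto simp: \<A>_def)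
    next
      fix \<F> assume fin: "finite \<F>" and "\<F> \<subseteq> uminus ` \<C>"
      then obtain \<D> where \<D>: "\<D> \<subseteq> \<C>" "finite \<D>" "\<F> = uminus ` \<D>"
        by (metis finite_subset_image)
      show "S \<inter> \<Inter>\<F> \<noteq> {}"
      proof (cases "\<D> = {}")
        case False
        then have "\<Union>\<D> \<in> \<D>"
          using \<D> lin by (intro Union_in_chain) (auto simp: subset_chain_def)
        then have "\<Union>\<D> \<in> \<A>" using \<D> sub by blast
        then have "- \<Union>\<D> \<noteq> {}" "- \<Union>\<D> \<subseteq> S" by (auto simp: \<A>_def)
        moreover have "- \<Union>\<D> = \<Inter>\<F>" using \<D>(3) by auto
        ultimately show ?thesis by auto
      qed (use assms \<D> in auto)
    qed
    then have "- \<Union>\<C> \<noteq> {}" by auto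
    moreover have "closed (- \<Union>\<C>)"
      using sub by (auto simp: \<A>_def closed_def)
    moreover have "- \<Union>\<C> \<subseteq> S" using ne sub by (auto simp: \<A>_def)
    moreover have "\<forall>h\<in>F. h ` (- \<Union>\<C>) \<subseteq> - \<Union>\<C>"
      using sub by (fastforce simp: \<A>_def)
    ultimately show "\<Union>\<C> \<in> \<A>" by (simp add: \<A>_def)
  qed
  then obtain M where M: "M \<in> \<A>" "\<And>U. \<lbrakk>U \<in> \<A>; M \<subseteq> U\<rbrakk> \<Longrightarrow> U = M" by blast
  show thesis
  proof
    show "K = - M" if "closed K" "K \<noteq> {}" "K \<subseteq> - M" "\<And>h. h \<in> F \<Longrightarrow> h ` K \<subseteq> K" for K
    proof -
      have "- K \<in> \<A>" using that M(1) by (auto simp: \<A>_def)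
      then show ?thesis using M(2)[of "- K"] that by auto
    qed
  qed (use M(1) in \<open>auto simp: \<A>_def\<close>)
qed

text \<open>Since the sizes of separated sets are bounded, one of greatest size exists, and no point
  can be added to it. \<open>R\<close> need be neither reflexive nor symmetric, which explains the
  three alternatives.\<close>

lemma maximal_separated_subset:
  assumes bound: "\<And>E. \<lbrakk>finite E; E \<subseteq> W; \<And>v w. \<lbrakk>v \<in> E; w \<in> E; v \<noteq> w\<rbrakk> \<Longrightarrow> \<not> R v w\<rbrakk> \<Longrightarrow> card E \<le> n"
  obtains E where "finite E" "E \<subseteq> W" "card E \<le> n"
    and "\<And>w. w \<in> W \<Longrightarrow> \<exists>e\<in>E. w = e \<or> R w e \<or> R e w"
proof -
  define P where "P E \<longleftrightarrow> finite E \<and> E \<subseteq> W \<and> (\<forall>v\<in>E. \<forall>w\<in>E. v \<noteq> w \<longrightarrow> \<not> R v w)" for E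
  have "P {}" by (simp add: P_def)
  moreover have le: "\<forall>E. P E \<longrightarrow> card E \<le> n" using bound by (simp add: P_def)
  ultimately obtain E where E: "P E" "\<And>F. P F \<Longrightarrow> card F \<le> card E"
    using ex_has_greatest_nat[of P "{}" card "Suc n"] by (auto simp: less_Suc_eq_le)
  show thesis
  proof
    fix w assume w: "w \<in> W"
    show "\<exists>e\<in>E. w = e \<or> R w e \<or> R e w"
    proof (rule ccontr)
      assume neg: "\<not> ?thesis"
      then have "w \<notin> E" by blast
      moreover have "P (insert w E)" using neg E(1) w by (auto simp: P_def)
      ultimately show False using E(1) E(2)[of "insert w E"] by (simp add: P_def)
    qed
  qed (use E(1) le in \<open>auto simp: P_def\<close>)
qed

section \<open>Averaging operators of means on a group\<close>

definition avg :: "('a, 'b) monoid_scheme \<Rightarrow> (('a \<Rightarrow> real) \<Rightarrow> real) \<Rightarrow> ('a \<Rightarrow> real) \<Rightarrow> 'a \<Rightarrow> real" where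
  "avg G \<mu> f z = \<mu> (\<lambda>x. f (z \<otimes>\<^bsub>G\<^esub> x))"

text \<open>Chosen so that its averaging operator is the composite of those of the two means, see
  \<open>avg_conv\<close>.\<close>

definition conv :: "('a, 'b) monoid_scheme \<Rightarrow> (('a \<Rightarrow> real) \<Rightarrow> real) \<Rightarrow> (('a \<Rightarrow> real) \<Rightarrow> real)
    \<Rightarrow> ('a \<Rightarrow> real) \<Rightarrow> real" where
  "conv G \<mu> \<nu> f = (if bounded (f ` carrier G) then \<mu> (avg G \<nu> f) else 0)"

text \<open>Point evaluation, cut off to 0 on unbounded functions as \<open>means\<close> demands.
  Its averaging operator is right translation by \<open>y\<close>.\<close>

definition dirac :: "('a, 'b) monoid_scheme \<Rightarrow> 'a \<Rightarrow> ('a \<Rightarrow> real) \<Rightarrow> real" where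
  "dirac G y f = (if bounded (f ` carrier G) then f y else 0)"

context group
begin

abbreviation "\<M> \<equiv> means (carrier G)"

lemma bounded_translate:
  fixes f :: "'a \<Rightarrow> real"
  assumes "bounded (f ` carrier G)" "z \<in> carrier G"
  shows "bounded ((\<lambda>x. f (z \<otimes> x)) ` carrier G)"
  by (rule bounded_subset[OF assms(1)]) (use assms(2) in auto)

lemma avg_abs_le:
  assumes "\<nu> \<in> \<M>" "\<And>x. x \<in> carrier G \<Longrightarrow> \<bar>f x\<bar> \<le> c" "z \<in> carrier G"
  shows "\<bar>avg G \<nu> f z\<bar> \<le> c"
  unfolding avg_def using assms by (intro mean_abs_le[OF assms(1)]) auto

lemma bounded_avg:
  assumes "\<nu> \<in> \<M>" "bounded (f ` carrier G)"
  shows "bounded (avg G \<nu> f ` carrier G)"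
proof -
  obtain c where "\<And>x. x \<in> carrier G \<Longrightarrow> \<bar>f x\<bar> \<le> c"
    using assms(2) by (auto simp: bounded_image_real_iff)
  then have "\<forall>z\<in>carrier G. \<bar>avg G \<nu> f z\<bar> \<le> c" by (simp add: avg_abs_le[OF assms(1)])
  then show ?thesis by (auto simp: bounded_image_real_iff)
qed

lemma avg_cong:
  assumes "\<nu> \<in> \<M>" "\<And>x. x \<in> carrier G \<Longrightarrow> f x = g x" "z \<in> carrier G"
  shows "avg G \<nu> f z = avg G \<nu> g z"
  unfolding avg_def using assms by (intro mean_cong[OF assms(1)]) auto

lemma avg_mono:
  assumes "\<nu> \<in> \<M>" "bounded (f ` carrier G)" "bounded (g ` carrier G)"
    "\<And>x. x \<in> carrier G \<Longrightarrow> f x \<le> g x" "z \<in> carrier G"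
  shows "avg G \<nu> f z \<le> avg G \<nu> g z"
  unfolding avg_def using assms by (intro mean_mono[OF assms(1)] bounded_translate) auto

lemma avg_const: "\<nu> \<in> \<M> \<Longrightarrow> avg G \<nu> (\<lambda>_. c) z = c"
  unfolding avg_def by (rule mean_const)

lemma avg_add:
  assumes "\<nu> \<in> \<M>" "bounded (f ` carrier G)" "bounded (g ` carrier G)" "z \<in> carrier G"
  shows "avg G \<nu> (\<lambda>x. f x + g x) z = avg G \<nu> f z + avg G \<nu> g z"
  unfolding avg_def using assms by (intro mean_add[OF assms(1)] bounded_translate)

lemma avg_diff:
  assumes "\<nu> \<in> \<M>" "bounded (f ` carrier G)" "bounded (g ` carrier G)" "z \<in> carrier G"
  shows "avg G \<nu> (\<lambda>x. f x - g x) z = avg G \<nu> f z - avg G \<nu> g z"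
  unfolding avg_def using assms by (intro mean_diff[OF assms(1)] bounded_translate)

lemma avg_mult:
  assumes "\<nu> \<in> \<M>" "bounded (f ` carrier G)" "z \<in> carrier G"
  shows "avg G \<nu> (\<lambda>x. c * f x) z = c * avg G \<nu> f z"
  unfolding avg_def using assms by (intro mean_mult[OF assms(1)] bounded_translate)

lemma conv_mean:
  assumes "\<mu> \<in> \<M>" "\<nu> \<in> \<M>"
  shows "conv G \<mu> \<nu> \<in> \<M>"
proof -
  have b: "bounded ((\<lambda>_::'a. 1::real) ` carrier G)" by (auto simp: bounded_image_real_iff)
  have "conv G \<mu> \<nu> (\<lambda>_. 1) = 1"
    using b mean_const[OF assms(1)] mean_cong[OF assms(1), of "avg G \<nu> (\<lambda>_. 1)" "\<lambda>_. 1"]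
    by (simp add: conv_def avg_const[OF assms(2)])
  moreover have "conv G \<mu> \<nu> (\<lambda>x. f x + g x) = conv G \<mu> \<nu> f + conv G \<mu> \<nu> g"
    if "bounded (f ` carrier G)" "bounded (g ` carrier G)" for f g
    using that bounded_plus_comp[OF that]
      mean_cong[OF assms(1) avg_add[OF assms(2) that]]
      mean_add[OF assms(1) bounded_avg[OF assms(2) that(1)] bounded_avg[OF assms(2) that(2)]]
    by (simp add: conv_def)
  moreover have "conv G \<mu> \<nu> (\<lambda>x. c * f x) = c * conv G \<mu> \<nu> f"
    if "bounded (f ` carrier G)" for f c
    using that bounded_image_mult[OF that, of c]
      mean_cong[OF assms(1) avg_mult[OF assms(2) that]]
      mean_mult[OF assms(1) bounded_avg[OF assms(2) that(1)]]
    by (simp add: conv_def)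
  moreover have "0 \<le> conv G \<mu> \<nu> f"
    if f: "bounded (f ` carrier G)" "\<forall>x\<in>carrier G. 0 \<le> f x" for f
  proof -
    have z: "bounded ((\<lambda>_::'a. 0::real) ` carrier G)" by (auto simp: bounded_image_real_iff)
    have "0 \<le> avg G \<nu> f x" if "x \<in> carrier G" for x
      using avg_mono[OF assms(2) z f(1), of x] f(2) that avg_const[OF assms(2)] by simp
    then show ?thesis
      using mean_mono[OF assms(1) z bounded_avg[OF assms(2) f(1)]] mean_const[OF assms(1)] f(1)
      by (simp add: conv_def)
  qed
  ultimately show ?thesis by (simp add: means_def conv_def)
qed

text \<open>Averaging operators commute with left translations, by associativity.\<close>

lemma avg_conv:
  assumes "\<mu> \<in> \<M>" "\<nu> \<in> \<M>" "bounded (f ` carrier G)" "z \<in> carrier G"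
  shows "avg G (conv G \<mu> \<nu>) f z = avg G \<mu> (avg G \<nu> f) z"
proof -
  have "\<mu> (avg G \<nu> (\<lambda>x. f (z \<otimes> x))) = \<mu> (\<lambda>x. avg G \<nu> f (z \<otimes> x))"
  proof (rule mean_cong[OF assms(1)])
    fix x assume x: "x \<in> carrier G"
    show "avg G \<nu> (\<lambda>x. f (z \<otimes> x)) x = avg G \<nu> f (z \<otimes> x)"
      unfolding avg_def using x assms(4) by (intro mean_cong[OF assms(2)]) (simp add: m_assoc)
  qed
  then show ?thesis
    using bounded_translate[OF assms(3,4)] by (simp add: avg_def conv_def)
qed

lemma dirac_mean:
  assumes "y \<in> carrier G"
  shows "dirac G y \<in> \<M>"
proof -
  have "bounded ((\<lambda>x. f x + g x) ` carrier G)"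
    if "bounded (f ` carrier G)" "bounded (g ` carrier G)" for f g :: "'a \<Rightarrow> real"
    using bounded_plus_comp[OF that] .
  moreover have "bounded ((\<lambda>x. c * f x) ` carrier G)"
    if "bounded (f ` carrier G)" for c and f :: "'a \<Rightarrow> real"
    using bounded_image_mult[OF that] .
  moreover have "bounded ((\<lambda>_::'a. 1::real) ` carrier G)"
    by (auto simp: bounded_image_real_iff)
  ultimately show ?thesis using assms by (simp add: means_def dirac_def)
qed

lemma avg_dirac:
  assumes "bounded (f ` carrier G)" "z \<in> carrier G"
  shows "avg G (dirac G y) f z = f (z \<otimes> y)"
  using bounded_translate[OF assms] by (simp add: avg_def dirac_def)

subsection \<open>Minimal means\<close>

text \<open>Any member of a minimal nonempty closed set \<open>L\<close> of means stable under left
  convolution by all means will do. If \<open>c\<close> bounds T_sigma T_mu f, the means in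
  \<open>L\<close> whose average of \<open>f\<close> is bounded by \<open>c\<close> form a closed
  stable subset containing \<open>conv G \<sigma> \<mu>\<close>; by minimality it is
  \<open>L\<close>, so it contains \<open>\<mu>\<close>.\<close>

lemma minimal_mean_exists:
  obtains \<mu> where "\<mu> \<in> \<M>"
    and "\<And>\<sigma> f c z. \<lbrakk>\<sigma> \<in> \<M>; bounded (f ` carrier G); z \<in> carrier G;
      \<And>w. w \<in> carrier G \<Longrightarrow> \<bar>avg G \<sigma> (avg G \<mu> f) w\<bar> \<le> c\<rbrakk> \<Longrightarrow> \<bar>avg G \<mu> f z\<bar> \<le> c"
proof -
  have "\<M> \<noteq> {}" using dirac_mean[OF one_closed] by blast
  moreover have "h ` \<M> \<subseteq> \<M>" if "h \<in> conv G ` \<M>" for h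
    using that conv_mean by auto
  ultimately obtain L where L: "closed L" "L \<noteq> {}" "L \<subseteq> \<M>"
      and inv: "\<And>h. h \<in> conv G ` \<M> \<Longrightarrow> h ` L \<subseteq> L"
      and minimal: "\<And>K. \<lbrakk>closed K; K \<noteq> {}; K \<subseteq> L; \<And>h. h \<in> conv G ` \<M> \<Longrightarrow> h ` K \<subseteq> K\<rbrakk> \<Longrightarrow> K = L"
    using minimal_invariant_closed_subset[OF compact_means closed_means, of "carrier G" "conv G ` \<M>"]
    by metis
  obtain \<mu> where \<mu>: "\<mu> \<in> L" using L by blast
  show thesis
  proof
    show "\<mu> \<in> \<M>" using \<mu> L by blast
  next
    fix \<sigma> f c z
    assume \<sigma>: "\<sigma> \<in> \<M>" and f: "bounded (f ` carrier G)" and z: "z \<in> carrier G"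
      and c: "\<And>w. w \<in> carrier G \<Longrightarrow> \<bar>avg G \<sigma> (avg G \<mu> f) w\<bar> \<le> c"
    define K where "K = {\<nu> \<in> L. \<forall>w\<in>carrier G. \<bar>avg G \<nu> f w\<bar> \<le> c}"
    have "K = L"
    proof (rule minimal)
      have "K = L \<inter> (\<Inter>w\<in>carrier G. {\<nu>. \<bar>\<nu> (\<lambda>x. f (w \<otimes> x))\<bar> \<le> c})"
        by (auto simp: K_def avg_def)
      moreover have "closed {\<nu>. \<bar>\<nu> g\<bar> \<le> c}" for g :: "'a \<Rightarrow> real"
        by (intro closed_Collect_le continuous_intros continuous_on_product_coordinates)
      ultimately show "closed K" using L by (simp add: closed_INT closed_Int)
    next
      have "conv G \<sigma> \<mu> \<in> K"
        using inv[of "conv G \<sigma>"] \<sigma> \<mu> L c avg_conv[OF \<sigma> _ f] by (auto simp: K_def)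
      then show "K \<noteq> {}" by blast
    next
      fix h assume "h \<in> conv G ` \<M>"
      then obtain \<tau> where \<tau>: "\<tau> \<in> \<M>" "h = conv G \<tau>" by blast
      have "conv G \<tau> \<nu> \<in> K" if "\<nu> \<in> K" for \<nu>
      proof -
        have \<nu>: "\<nu> \<in> L" "\<nu> \<in> \<M>" "\<And>w. w \<in> carrier G \<Longrightarrow> \<bar>avg G \<nu> f w\<bar> \<le> c"
          using that L by (auto simp: K_def)
        then have "conv G \<tau> \<nu> \<in> L" using inv[of "conv G \<tau>"] \<tau> by blast
        then show ?thesis
          using avg_conv[OF \<tau>(1) \<nu>(2) f] avg_abs_le[OF \<tau>(1) \<nu>(3)] by (simp add: K_def)
      qed
      then show "h ` K \<subseteq> K" using \<tau> by blast
    qed (auto simp: K_def)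
    then show "\<bar>avg G \<mu> f z\<bar> \<le> c" using \<mu> z by (auto simp: K_def)
  qed
qed

text \<open>Exponent 0 is the unit for convolution: its averaging operator is the identity on
  bounded functions, so that the telescoping sum below ends in \<open>g\<close> itself.\<close>

fun conv_pow :: "(('a \<Rightarrow> real) \<Rightarrow> real) \<Rightarrow> nat \<Rightarrow> ('a \<Rightarrow> real) \<Rightarrow> real" where
  "conv_pow \<tau> 0 = dirac G \<one>"
| "conv_pow \<tau> (Suc j) = conv G (conv_pow \<tau> j) \<tau>"

lemma conv_pow_mean: "\<tau> \<in> \<M> \<Longrightarrow> conv_pow \<tau> j \<in> \<M>"
  by (induction j) (auto intro: conv_mean dirac_mean)

lemma cesaro_mean:
  assumes "\<tau> \<in> \<M>" "0 < k"
  shows "(\<lambda>f. (\<Sum>j<k. conv_pow \<tau> j f) / real k) \<in> \<M>"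
proof -
  note m = conv_pow_mean[OF assms(1)]
  show ?thesis
    using assms(2) m unfolding means_def
    by (auto simp: sum.distrib add_divide_distrib sum_distrib_left[symmetric]
        intro!: divide_nonneg_nonneg sum_nonneg)
qed

text \<open>Composing the operator of the j-th convolution power with that of \<open>\<tau>\<close>
  gives the next power, so the sum telescopes. The resulting factor 1/k is what makes Cesaro means
  useful.\<close>

lemma avg_cesaro_telescope:
  assumes \<tau>: "\<tau> \<in> \<M>" and g: "bounded (g ` carrier G)" and z: "z \<in> carrier G"
  shows "avg G (\<lambda>f. (\<Sum>j<k. conv_pow \<tau> j f) / real k) (\<lambda>x. avg G \<tau> g x - g x) z
    = (avg G (conv_pow \<tau> k) g z - g z) / real k"
proof -
  have "avg G (conv_pow \<tau> j) (\<lambda>x. avg G \<tau> g x - g x) z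
      = avg G (conv_pow \<tau> (Suc j)) g z - avg G (conv_pow \<tau> j) g z" for j
    using avg_diff[OF conv_pow_mean[OF \<tau>] bounded_avg[OF \<tau> g] g z]
      avg_conv[OF conv_pow_mean[OF \<tau>] \<tau> g z] by simp
  then have "(\<Sum>j<k. avg G (conv_pow \<tau> j) (\<lambda>x. avg G \<tau> g x - g x) z)
      = avg G (conv_pow \<tau> k) g z - avg G (conv_pow \<tau> 0) g z"
    using sum_lessThan_telescope[of "\<lambda>j. avg G (conv_pow \<tau> j) g z" k] by simp
  moreover have "avg G (\<lambda>f. (\<Sum>j<k. conv_pow \<tau> j f) / real k) (\<lambda>x. avg G \<tau> g x - g x) z
      = (\<Sum>j<k. avg G (conv_pow \<tau> j) (\<lambda>x. avg G \<tau> g x - g x) z) / real k"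
    by (simp add: avg_def)
  ultimately show ?thesis
    using avg_dirac[OF g z, of \<one>] z by simp
qed

text \<open>With d = T_sigma T_mu f - f the claim is T_mu d = 0. Now T_mu d = T_tau g - g for tau =
  mu * sigma, which Cesaro means of tau shrink to size O(1/k). Minimality forbids an average to be
  smaller in sup norm than T_mu d, so T_mu d vanishes.\<close>

lemma minimal_mean_absorbs:
  assumes \<mu>: "\<mu> \<in> \<M>"
    and minimal: "\<And>\<sigma> f c z. \<lbrakk>\<sigma> \<in> \<M>; bounded (f ` carrier G); z \<in> carrier G;
      \<And>w. w \<in> carrier G \<Longrightarrow> \<bar>avg G \<sigma> (avg G \<mu> f) w\<bar> \<le> c\<rbrakk> \<Longrightarrow> \<bar>avg G \<mu> f z\<bar> \<le> c"
    and \<sigma>: "\<sigma> \<in> \<M>" and f: "bounded (f ` carrier G)" and z: "z \<in> carrier G"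
  shows "avg G \<mu> (avg G \<sigma> (avg G \<mu> f)) z = avg G \<mu> f z"
proof -
  define g where "g = avg G \<mu> f"
  define \<tau> where "\<tau> = conv G \<mu> \<sigma>"
  define d where "d x = avg G \<sigma> g x - f x" for x
  have g: "bounded (g ` carrier G)" unfolding g_def by (rule bounded_avg[OF \<mu> f])
  have \<tau>: "\<tau> \<in> \<M>" unfolding \<tau>_def by (rule conv_mean[OF \<mu> \<sigma>])
  have \<sigma>g: "bounded (avg G \<sigma> g ` carrier G)" by (rule bounded_avg[OF \<sigma> g])
  have d: "bounded (d ` carrier G)" unfolding d_def by (rule bounded_minus_comp[OF \<sigma>g f])
  have avg_d: "avg G \<mu> d x = avg G \<tau> g x - g x" if "x \<in> carrier G" for x
    using avg_diff[OF \<mu> \<sigma>g f that] avg_conv[OF \<mu> \<sigma> g that]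
    by (simp add: d_def[abs_def] \<tau>_def g_def)
  obtain c where c: "\<And>x. x \<in> carrier G \<Longrightarrow> \<bar>g x\<bar> \<le> c"
    using g by (auto simp: bounded_image_real_iff)
  \<comment> \<open>Minimality is applied to the function \<open>d\<close>, with the Cesaro mean as
    the competing mean. The numerator of the telescoped sum is a difference of two terms bounded by
    \<open>c\<close>.\<close>
  have bound: "\<bar>avg G \<mu> d z\<bar> \<le> 2 * c / real k" if k: "0 < k" for k
  proof (rule minimal[OF cesaro_mean[OF \<tau> k] d z])
    fix w assume w: "w \<in> carrier G"
    have "avg G (\<lambda>f. (\<Sum>j<k. conv_pow \<tau> j f) / real k) (avg G \<mu> d) w
        = (avg G (conv_pow \<tau> k) g w - g w) / real k"
      using avg_cong[OF cesaro_mean[OF \<tau> k] avg_d w] avg_cesaro_telescope[OF \<tau> g w] by simp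
    moreover have "\<bar>avg G (conv_pow \<tau> k) g w - g w\<bar> \<le> 2 * c"
      using avg_abs_le[OF conv_pow_mean[OF \<tau>, of k], of g c w] c w by fastforce
    ultimately show "\<bar>avg G (\<lambda>f. (\<Sum>j<k. conv_pow \<tau> j f) / real k) (avg G \<mu> d) w\<bar> \<le> 2 * c / real k"
      using k by (simp add: divide_right_mono)
  qed
  have "(\<lambda>k. 2 * c / real k) \<longlonglongrightarrow> 0" by (rule lim_const_over_n)
  then have "\<bar>avg G \<mu> d z\<bar> \<le> 0"
    using bound by (intro tendsto_lowerbound) (auto intro: eventually_sequentiallyI[of 1])
  then show ?thesis
    using avg_d[OF z] avg_conv[OF \<mu> \<sigma> g z] by (simp add: g_def \<tau>_def)
qed

subsection \<open>Covering the group by a cell of the partition\<close>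

definition quot_set :: "'a set \<Rightarrow> 'a set" where
  "quot_set A = A <#> set_inv A"

lemma quot_set_iff: "x \<in> quot_set A \<longleftrightarrow> (\<exists>a\<in>A. \<exists>b\<in>A. x = a \<otimes> inv b)"
  by (auto simp: quot_set_def set_mult_def SET_INV_def)

text \<open>The point \<open>x\<close> witnesses that the translates inv(v) A and inv(w) A
  meet.\<close>

lemma mem_quot_setI:
  assumes "A \<subseteq> carrier G" "v \<in> carrier G" "w \<in> carrier G" "x \<in> carrier G"
    "v \<otimes> x \<in> A" "w \<otimes> x \<in> A"
  shows "v \<otimes> inv w \<in> quot_set A"
proof -
  have "(v \<otimes> x) \<otimes> inv (w \<otimes> x) = v \<otimes> inv w"
    using assms by (simp add: inv_mult_group m_assoc[symmetric]) (simp add: m_assoc)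
  then show ?thesis using assms unfolding quot_set_iff by metis
qed

text \<open>Separation makes the sets inv(w) A for w in \<open>E\<close> disjoint, and the average
  at w is the mean of inv(w) A. Disjoint sets have total mean at most 1, so fewer than n + 1 of them
  exceed 1/(n+1).\<close>

lemma avg_level_separated_card:
  assumes \<mu>: "\<mu> \<in> \<M>" and A: "A \<subseteq> carrier G"
    and E: "finite E" "E \<subseteq> carrier G"
    and big: "\<And>w. w \<in> E \<Longrightarrow> avg G \<mu> (indicator A) w > 1 / (real n + 1)"
    and sep: "\<And>v w. \<lbrakk>v \<in> E; w \<in> E; v \<noteq> w\<rbrakk> \<Longrightarrow> v \<otimes> inv w \<notin> quot_set A"
  shows "card E \<le> n"
proof (rule ccontr)
  assume "\<not> card E \<le> n"
  then have n: "real n + 1 \<le> real (card E)" by simp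
  let ?f = "\<lambda>w x. indicator A (w \<otimes> x) :: real"
  have bf: "bounded (?f w ` carrier G)" for w
    by (auto simp: bounded_image_real_iff indicator_def intro!: exI[of _ 1])
  have "(\<Sum>w\<in>E. 1 / (real n + 1)) < (\<Sum>w\<in>E. avg G \<mu> (indicator A) w)"
    using E big n by (intro sum_strict_mono) auto
  also have "\<dots> = \<mu> (\<lambda>x. \<Sum>w\<in>E. ?f w x)"
    unfolding avg_def by (rule mean_sum[OF \<mu> bf, symmetric])
  also have "\<dots> \<le> \<mu> (\<lambda>_. 1)"
  proof (rule mean_mono[OF \<mu>])
    show "bounded ((\<lambda>x. \<Sum>w\<in>E. ?f w x) ` carrier G)" by (intro bounded_image_sum bf)
    show "bounded ((\<lambda>_::'a. 1::real) ` carrier G)" by (auto simp: bounded_image_real_iff)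
  next
    fix x assume x: "x \<in> carrier G"
    have uniq: "v = w" if "v \<in> E" "w \<in> E" "v \<otimes> x \<in> A" "w \<otimes> x \<in> A" for v w
      using sep[of v w] mem_quot_setI[OF A, of v w x] that E x by blast
    \<comment> \<open>The sum counts the translates containing \<open>x\<close>, at most one by
      disjointness.\<close>
    have "(\<Sum>w\<in>E. ?f w x) = real (card {w\<in>E. w \<otimes> x \<in> A})"
      using E by (simp add: indicator_def sum.If_cases Int_def of_bool_def)
    moreover have "card {w\<in>E. w \<otimes> x \<in> A} \<le> 1"
      using uniq E by (subst card_le_Suc0_iff_eq[unfolded One_nat_def[symmetric]]) auto
    ultimately show "(\<Sum>w\<in>E. ?f w x) \<le> 1" by simp
  qed
  also have "\<dots> = 1" by (rule mean_const[OF \<mu>])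
  finally have "real (card E) < real n + 1" by (simp add: field_simps)
  then show False using n by simp
qed

lemma quot_set_inv:
  assumes "A \<subseteq> carrier G" "x \<in> quot_set A"
  shows "inv x \<in> quot_set A"
  using assms unfolding quot_set_iff
  by (metis inv_closed inv_inv inv_mult_group subsetD)

text \<open>The analytic input of the theorem. In the factorisation of \<open>x\<close>,
  \<open>b\<close> comes from moving a point into the level set \<open>W\<close>, and
  \<open>c\<close> from moving on to the separated set \<open>E\<close>.\<close>

lemma partition_cell_cover:
  fixes A :: "nat \<Rightarrow> 'a set"
  assumes disj: "disjoint_family_on A {1..n}" and un: "(\<Union>i\<in>{1..n}. A i) = carrier G"
  obtains i E where "i \<in> {1..n}" "A i \<noteq> {}" "finite E" "E \<subseteq> carrier G" "card E \<le> n"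
    and "\<And>x. x \<in> carrier G \<Longrightarrow> \<exists>b\<in>quot_set (A i). \<exists>c\<in>quot_set (A i). \<exists>e\<in>E. x = b \<otimes> c \<otimes> e"
proof -
  obtain \<mu> where \<mu>: "\<mu> \<in> \<M>" and minimal: "\<And>\<sigma> f c z. \<lbrakk>\<sigma> \<in> \<M>; bounded (f ` carrier G); z \<in> carrier G;
      \<And>w. w \<in> carrier G \<Longrightarrow> \<bar>avg G \<sigma> (avg G \<mu> f) w\<bar> \<le> c\<rbrakk> \<Longrightarrow> \<bar>avg G \<mu> f z\<bar> \<le> c"
    using minimal_mean_exists by blast
  note bi = bounded_image_indicator[where X = "carrier G"]
  have n: "0 < n" using un one_closed by (cases n) auto
  have "(\<Sum>i\<in>{1..n}. \<mu> (indicator (A i))) = \<mu> (\<lambda>x. \<Sum>i\<in>{1..n}. indicator (A i) x)"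
    by (rule mean_sum[OF \<mu> bi, symmetric])
  also have "\<dots> = \<mu> (\<lambda>_. 1)"
  proof (rule mean_cong[OF \<mu>])
    fix x assume "x \<in> carrier G"
    then show "(\<Sum>i\<in>{1..n}. indicator (A i) x) = (1::real)"
      using indicator_UN_disjoint[OF finite_atLeastAtMost disj, of x] un by (metis indicator_simps(1))
  qed
  also have "\<dots> = 1" by (rule mean_const[OF \<mu>])
  finally have total: "(\<Sum>i\<in>{1..n}. \<mu> (indicator (A i))) = 1" .
  have "\<exists>i\<in>{1..n}. 1 / real n \<le> \<mu> (indicator (A i))"
  proof (rule ccontr)
    assume "\<not> ?thesis"
    then have "(\<Sum>i\<in>{1..n}. \<mu> (indicator (A i))) < (\<Sum>i\<in>{1..n}. 1 / real n)"
      using n by (intro sum_strict_mono) (auto simp: not_le)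
    then show False using n total by simp
  qed
  then obtain i where i: "i \<in> {1..n}" "1 / real n \<le> \<mu> (indicator (A i))" by blast
  define B where "B = A i"
  have B: "B \<subseteq> carrier G" using i un by (auto simp: B_def)
  have B_ne: "B \<noteq> {}"
  proof
    assume "B = {}"
    then have "\<mu> (indicator B) = 0" using mean_const[OF \<mu>, of 0] mean_cong[OF \<mu>, of "indicator B" "\<lambda>_. 0"] by simp
    then show False using i n by (simp add: B_def)
  qed
  define h where "h = avg G \<mu> (indicator B)"
  have h: "bounded (h ` carrier G)" unfolding h_def by (rule bounded_avg[OF \<mu> bi])
  have h_one: "1 / real n \<le> h \<one>"
    using i mean_cong[OF \<mu>, of "indicator B" "\<lambda>x. indicator B (\<one> \<otimes> x)"]
    by (simp add: h_def avg_def B_def)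
  \<comment> \<open>The threshold 1/(n+1) lies strictly below 1/n, which leaves a gap to the
    supremum of \<open>h\<close>, yet is large enough to bound separated subsets of \<open>W\<close>
    by n.\<close>
  have hit: "\<exists>a\<in>B. 1 / (real n + 1) < h (a \<otimes> y)" if y: "y \<in> carrier G" for y
  proof (rule ccontr)
    assume neg: "\<not> ?thesis"
    define m where "m = Sup (h ` carrier G)"
    have le_m: "h x \<le> m" if "x \<in> carrier G" for x
      unfolding m_def using that h by (intro cSup_upper bounded_imp_bdd_above) auto
    define \<epsilon> where "\<epsilon> = m - 1 / (real n + 1)"
    have "1 / (real n + 1) < 1 / real n" using n by (simp add: field_simps)
    then have m: "0 < m" "0 < \<epsilon>"
      using h_one le_m[OF one_closed] n unfolding \<epsilon>_def
      by (smt (verit) divide_pos_pos of_nat_0_less_iff)+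
    have shift: "avg G (dirac G y) h x = h (x \<otimes> y)" if "x \<in> carrier G" for x
      by (rule avg_dirac[OF h that])
    \<comment> \<open>If \<open>hit\<close> fails, translation by \<open>y\<close> brings
      \<open>h\<close> down to at most m - epsilon on \<open>B\<close>, and to at most m elsewhere.
      Averaging gives back \<open>h\<close> on the left by \<open>minimal_mean_absorbs\<close>,
      hence h <= m - epsilon h. The resulting bound is below the supremum m.\<close>
    have "h g \<le> m / (1 + \<epsilon>)" if g: "g \<in> carrier G" for g
    proof -
      have b1: "bounded ((\<lambda>_. m) ` carrier G)" by (auto simp: bounded_image_real_iff)
      have b2: "bounded ((\<lambda>x. \<epsilon> * indicator B x) ` carrier G)" by (rule bounded_image_mult[OF bi])
      have "h g = avg G \<mu> (avg G (dirac G y) h) g"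
        unfolding h_def
        using minimal_mean_absorbs[OF \<mu> minimal dirac_mean[OF y] bi g] by simp
      also have "\<dots> \<le> avg G \<mu> (\<lambda>x. m - \<epsilon> * indicator B x) g"
      proof (rule avg_mono[OF \<mu> _ _ _ g])
        show "bounded (avg G (dirac G y) h ` carrier G)"
          by (rule bounded_avg[OF dirac_mean[OF y] h])
        show "bounded ((\<lambda>x. m - \<epsilon> * indicator B x) ` carrier G)"
          by (rule bounded_minus_comp[OF b1 b2])
        show "avg G (dirac G y) h x \<le> m - \<epsilon> * indicator B x" if "x \<in> carrier G" for x
          using that y neg le_m[of "x \<otimes> y"] shift[OF that]
          by (auto simp: indicator_def \<epsilon>_def not_less)
      qed
      also have "\<dots> = m - \<epsilon> * h g"
        using avg_diff[OF \<mu> b1 b2 g] avg_mult[OF \<mu> bi g] avg_const[OF \<mu>] by (simp add: h_def)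
      finally show ?thesis using m by (simp add: field_simps)
    qed
    then have "m \<le> m / (1 + \<epsilon>)" unfolding m_def[symmetric]
      by (subst m_def) (intro cSup_least, auto)
    then show False using m by (simp add: field_simps mult_le_0_iff)
  qed
  define W where "W = {w \<in> carrier G. 1 / (real n + 1) < h w}"
  obtain E where E: "finite E" "E \<subseteq> W" "card E \<le> n"
    and near: "\<And>w. w \<in> W \<Longrightarrow>
      \<exists>e\<in>E. w = e \<or> w \<otimes> inv e \<in> quot_set B \<or> e \<otimes> inv w \<in> quot_set B"
  proof (rule maximal_separated_subset[of W "\<lambda>v w. v \<otimes> inv w \<in> quot_set B" n])
    fix E assume "finite E" "E \<subseteq> W" "\<And>v w. \<lbrakk>v \<in> E; w \<in> E; v \<noteq> w\<rbrakk> \<Longrightarrow> v \<otimes> inv w \<notin> quot_set B"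
    then show "card E \<le> n"
      by (intro avg_level_separated_card[OF \<mu> B]) (auto simp: W_def h_def)
  qed blast
  have E_car: "E \<subseteq> carrier G" using E by (auto simp: W_def)
  obtain p where p: "p \<in> B" using B_ne by blast
  have "\<exists>b\<in>quot_set B. \<exists>c\<in>quot_set B. \<exists>e\<in>E. x = b \<otimes> c \<otimes> e" if x: "x \<in> carrier G" for x
  proof -
    have pc: "p \<in> carrier G" using p B by blast
    \<comment> \<open>With w = a y in \<open>W\<close> this makes x = p y = (p inv(a)) w, whose
      first factor is in \<open>quot_set B\<close>.\<close>
    define y where "y = inv p \<otimes> x"
    have y: "y \<in> carrier G" using x pc by (simp add: y_def)
    obtain a where a: "a \<in> B" "1 / (real n + 1) < h (a \<otimes> y)" using hit[OF y] by blast
    have ac: "a \<in> carrier G" using a B by blast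
    define w where "w = a \<otimes> y"
    have w: "w \<in> W" "w \<in> carrier G" using a ac y by (auto simp: W_def w_def)
    obtain e where e: "e \<in> E"
      and near_e: "w = e \<or> w \<otimes> inv e \<in> quot_set B \<or> e \<otimes> inv w \<in> quot_set B"
      using near[OF w(1)] by blast
    have ec: "e \<in> carrier G" using e E_car by blast
    have "\<one> \<in> quot_set B" using p pc unfolding quot_set_iff by force
    moreover have "w \<otimes> inv e \<in> quot_set B" if "e \<otimes> inv w \<in> quot_set B"
      using quot_set_inv[OF B that] ec w(2) by (simp add: inv_mult_group)
    ultimately have c: "w \<otimes> inv e \<in> quot_set B" using near_e ec by auto
    have b: "p \<otimes> inv a \<in> quot_set B" using p a by (auto simp: quot_set_iff)
    have "x = (p \<otimes> inv a) \<otimes> (w \<otimes> inv e) \<otimes> e"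
    proof -
      have "(w \<otimes> inv e) \<otimes> e = w" using w ec by (simp add: m_assoc)
      moreover have "inv a \<otimes> w = y" using ac y by (simp add: w_def m_assoc[symmetric])
      moreover have "p \<otimes> y = x" using pc x by (simp add: y_def m_assoc[symmetric])
      ultimately show ?thesis using pc ac w ec by (simp add: m_assoc)
    qed
    then show ?thesis using b c e by blast
  qed
  then show thesis using that[of i E] i E E_car B_ne by (simp add: B_def)
qed

subsection \<open>Powers of a symmetric set\<close>

text \<open>The value at exponent 0 extends the recursion down to the step from 0 to 1, so
  inductions can start at 0.\<close>

lemma set_power_Suc:
  assumes "B \<subseteq> carrier G"
  shows "set_power G B (Suc k) = set_power G B k <#> B"
  using assms by (cases k) (auto simp: set_mult_def subset_iff)

lemma set_power_subset: "B \<subseteq> carrier G \<Longrightarrow> set_power G B k \<subseteq> carrier G"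
  by (induction k) (auto simp: set_power_Suc simp del: set_power.simps(2,3) dest: set_mult_closed)

lemma set_power_add:
  assumes "B \<subseteq> carrier G"
  shows "set_power G B (j + k) = set_power G B j <#> set_power G B k"
proof (induction k)
  case 0
  then show ?case using set_power_subset[OF assms, of j] by (auto simp: set_mult_def subset_iff)
next
  case (Suc k)
  then show ?case
    using assms set_power_subset[OF assms] by (simp add: set_power_Suc set_mult_assoc del: set_power.simps(2,3))
qed

lemma set_power_mono:
  assumes "B \<subseteq> carrier G" "\<one> \<in> B" "j \<le> k"
  shows "set_power G B j \<subseteq> set_power G B k"
proof -
  have "set_power G B l \<subseteq> set_power G B (Suc l)" for l
  proof
    fix x assume x: "x \<in> set_power G B l"
    then have "x \<in> carrier G" using set_power_subset[OF assms(1)] by blast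
    then have "x = x \<otimes> \<one>" by simp
    then show "x \<in> set_power G B (Suc l)"
      unfolding set_power_Suc[OF assms(1)] set_mult_def using x assms(2) by blast
  qed
  then show ?thesis using assms(3) by (rule lift_Suc_mono_le)
qed

lemma set_power_stable:
  assumes "B \<subseteq> carrier G" "set_power G B (Suc l) = set_power G B l" "l \<le> k"
  shows "set_power G B k = set_power G B l"
  using assms(3)
proof (induction k rule: dec_induct)
  case (step k)
  then show ?case using assms(2) by (simp add: set_power_Suc[OF assms(1)] del: set_power.simps(2,3))
qed simp

text \<open>Inversion reverses products, so the last factor becomes the first;
  \<open>set_power_add\<close> with exponents 1 and k reabsorbs it.\<close>

lemma set_power_inv:
  assumes "B \<subseteq> carrier G" "\<And>b. b \<in> B \<Longrightarrow> inv b \<in> B" "x \<in> set_power G B k"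
  shows "inv x \<in> set_power G B k"
  using assms(3)
proof (induction k arbitrary: x)
  case (Suc k)
  have sub: "set_power G B k \<subseteq> carrier G" by (rule set_power_subset[OF assms(1)])
  obtain y b where y: "y \<in> set_power G B k" "b \<in> B" "x = y \<otimes> b"
    using Suc.prems by (auto simp: set_power_Suc[OF assms(1)] set_mult_def simp del: set_power.simps(2,3))
  have "inv x = inv b \<otimes> inv y" using y sub assms(1) by (simp add: inv_mult_group subset_iff)
  then have "inv x \<in> set_power G B 1 <#> set_power G B k"
    using Suc.IH[OF y(1)] assms(2)[OF y(2)] by (auto simp: set_mult_def)
  then show ?case using set_power_add[OF assms(1), of 1 k] by simp
qed auto

text \<open>A product of two elements lies in the power with exponent l + l, which stability
  identifies with the l-th power.\<close>

lemma stable_set_power_subgroup: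
  assumes B: "B \<subseteq> carrier G" "\<one> \<in> B" "\<And>b. b \<in> B \<Longrightarrow> inv b \<in> B"
    and stable: "set_power G B (Suc l) = set_power G B l"
  shows "subgroup (set_power G B l) G"
proof
  show "set_power G B l \<subseteq> carrier G" by (rule set_power_subset[OF B(1)])
  show "x \<otimes> y \<in> set_power G B l" if "x \<in> set_power G B l" "y \<in> set_power G B l" for x y
  proof -
    have "x \<otimes> y \<in> set_power G B (l + l)"
      using that unfolding set_power_add[OF B(1)] by (auto simp: set_mult_def)
    then show ?thesis using set_power_stable[OF B(1) stable, of "l + l"] by simp
  qed
  show "\<one> \<in> set_power G B l" using set_power_mono[OF B(1,2), of 0 l] by auto
  show "inv x \<in> set_power G B l" if "x \<in> set_power G B l" for x
    by (rule set_power_inv[OF B(1,3) that])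
qed

lemma subgroup_index_le_of_cover:
  assumes H: "subgroup H G" and E: "finite E" "E \<subseteq> carrier G" "card E \<le> n"
    and cover: "\<And>x. x \<in> carrier G \<Longrightarrow> \<exists>h\<in>H. \<exists>e\<in>E. x = h \<otimes> e"
  shows "subgroup_of_index_le G H n"
proof -
  have "rcosets H \<subseteq> (\<lambda>e. H #> e) ` E"
  proof
    fix C assume "C \<in> rcosets H"
    then obtain x where x: "x \<in> carrier G" "C = H #> x" by (auto simp: RCOSETS_def)
    obtain h e where he: "h \<in> H" "e \<in> E" "x = h \<otimes> e" using cover[OF x(1)] by blast
    have "H #> x = H #> e"
      using he E H repr_independence[of x H e] by (auto simp: r_coset_def)
    then show "C \<in> (\<lambda>e. H #> e) ` E" using x he by blast
  qed
  then have "finite (rcosets H)" "card (rcosets H) \<le> card ((\<lambda>e. H #> e) ` E)"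
    using E(1) by (auto intro: finite_subset card_mono)
  then show ?thesis
    using H E(3) card_image_le[OF E(1), of "\<lambda>e. H #> e"] by (simp add: subgroup_of_index_le_def)
qed

lemma set_power_diff:
  assumes B: "B \<subseteq> carrier G" and x: "x \<in> carrier G" and y: "y \<in> set_power G B k"
    and "x \<otimes> inv y \<in> set_power G B j"
  shows "x \<in> set_power G B (j + k)"
proof -
  have "y \<in> carrier G" using y set_power_subset[OF B] by blast
  then have "x = (x \<otimes> inv y) \<otimes> y" using x by (simp add: m_assoc)
  then show ?thesis unfolding set_power_add[OF B] set_mult_def using assms by blast
qed

text \<open>Otherwise there are n + 1 points, the j-th first appearing at exponent 5j, and two of
  them share a translate of B^2. Their quotient lies in B^4, so the later one already appears at
  exponent 4 + 5j, too early.\<close>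

lemma set_power_stable_of_cover:
  assumes B: "B \<subseteq> carrier G" "\<one> \<in> B" "\<And>b. b \<in> B \<Longrightarrow> inv b \<in> B"
    and E: "finite E" "E \<subseteq> carrier G" "card E \<le> n"
    and cover: "\<And>x. x \<in> carrier G \<Longrightarrow> \<exists>b\<in>set_power G B 2. \<exists>e\<in>E. x = b \<otimes> e"
    and l: "5 * n \<le> Suc l"
  shows "set_power G B (Suc l) = set_power G B l"
proof (rule ccontr)
  assume unstable: "set_power G B (Suc l) \<noteq> set_power G B l"
  have "\<exists>p. p \<in> set_power G B (5 * j) \<and> (\<forall>k<5 * j. p \<notin> set_power G B k)" if j: "j \<le> n" for j
  proof (cases j)
    case 0
    then show ?thesis by auto
  next
    case (Suc i)
    define q where "q = 5 * j - 1"
    have q: "5 * j = Suc q" "q \<le> l" using Suc j l by (auto simp: q_def)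
    \<comment> \<open>Stability at \<open>q\<close> would persist to all larger exponents,
      contradicting the growth at \<open>l\<close>. The hypothesis on \<open>l\<close> guarantees q
      <= l even for j = n.\<close>
    have "set_power G B (Suc q) \<noteq> set_power G B q"
      using set_power_stable[OF B(1), of q] unstable q(2) by (metis le_Suc_eq)
    then obtain p where p: "p \<in> set_power G B (Suc q)" "p \<notin> set_power G B q"
      using set_power_mono[OF B(1,2), of q "Suc q"] by auto
    have "p \<notin> set_power G B k" if "k < 5 * j" for k
      using p(2) set_power_mono[OF B(1,2), of k q] that q(1) by auto
    then show ?thesis using p q by metis
  qed
  then obtain p where p: "\<And>j. j \<le> n \<Longrightarrow> p j \<in> set_power G B (5 * j)"
      "\<And>j k. \<lbrakk>j \<le> n; k < 5 * j\<rbrakk> \<Longrightarrow> p j \<notin> set_power G B k"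
    by metis
  have pc: "p j \<in> carrier G" if "j \<le> n" for j using p(1)[OF that] set_power_subset[OF B(1)] by blast
  have "\<exists>e\<in>E. \<exists>b\<in>set_power G B 2. p j = b \<otimes> e" if "j \<le> n" for j
    using cover[OF pc[OF that]] by blast
  then obtain e where e: "\<And>j. j \<le> n \<Longrightarrow> e j \<in> E \<and> (\<exists>b\<in>set_power G B 2. p j = b \<otimes> e j)"
    by metis
  have "\<not> inj_on e {..n}"
  proof
    assume "inj_on e {..n}"
    then have "card {..n} \<le> card E" using e E(1) by (intro card_inj_on_le) auto
    then show False using E(3) by simp
  qed
  then obtain j k where jk: "j \<le> n" "k \<le> n" "e j = e k" "j < k"
    unfolding inj_on_def by (metis atMost_iff linorder_neqE_nat)
  obtain b c where bc: "b \<in> set_power G B 2" "p k = b \<otimes> e k" "c \<in> set_power G B 2" "p j = c \<otimes> e k"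
    using e[OF jk(1)] e[OF jk(2)] jk(3) by metis
  have car: "b \<in> carrier G" "c \<in> carrier G" "e k \<in> carrier G"
    using bc e[OF jk(2)] E(2) set_power_subset[OF B(1)] by auto
  have "p k \<otimes> inv (p j) = b \<otimes> inv c"
    using bc car by (simp add: inv_mult_group m_assoc[symmetric]) (simp add: m_assoc)
  moreover have "b \<otimes> inv c \<in> set_power G B (2 + 2)"
    using bc set_power_inv[OF B(1,3) bc(3)] unfolding set_power_add[OF B(1)] set_mult_def by blast
  ultimately have "p k \<in> set_power G B (4 + 5 * j)"
    using set_power_diff[OF B(1) pc[OF jk(2)] p(1)[OF jk(1)], of 4] by simp
  then show False using p(2)[OF jk(2), of "4 + 5 * j"] jk(4) by simp
qed

text \<open>A new point p of B^2 and a new point q of B^5 both lie outside \<open>B\<close>, hence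
  in the same translate B g. Then q inv(p) is in B^2, which puts q into B^4.\<close>

lemma set_power_stable_of_two_translates:
  assumes B: "B \<subseteq> carrier G" "\<one> \<in> B" "\<And>b. b \<in> B \<Longrightarrow> inv b \<in> B"
    and g: "g \<in> carrier G"
    and cover: "\<And>x. x \<in> carrier G \<Longrightarrow> x \<in> B \<or> (\<exists>b\<in>B. x = b \<otimes> g)"
  shows "set_power G B 5 = set_power G B 4"
proof (rule ccontr)
  assume unstable: "set_power G B 5 \<noteq> set_power G B 4"
  have "set_power G B 2 \<noteq> set_power G B 1"
    using set_power_stable[OF B(1), of 1 4] set_power_stable[OF B(1), of 1 5] unstable
    by (auto simp: numeral_2_eq_2)
  then obtain p where p: "p \<in> set_power G B 2" "p \<notin> B"
    using set_power_mono[OF B(1,2), of 1 2] by auto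
  obtain q where q: "q \<in> set_power G B 5" "q \<notin> set_power G B 4"
    using set_power_mono[OF B(1,2), of 4 5] unstable by auto
  have "q \<notin> B" using q(2) set_power_mono[OF B(1,2), of 1 4] by auto
  have pq: "p \<in> carrier G" "q \<in> carrier G" using p q set_power_subset[OF B(1)] by blast+
  obtain b c where bc: "b \<in> B" "c \<in> B" "q = b \<otimes> g" "p = c \<otimes> g"
    using cover pq \<open>q \<notin> B\<close> p(2) by metis
  have car: "b \<in> carrier G" "c \<in> carrier G" using bc B(1) by auto
  have "q \<otimes> inv p = b \<otimes> inv c"
    using bc car g by (simp add: inv_mult_group m_assoc[symmetric]) (simp add: m_assoc)
  moreover have "b \<otimes> inv c \<in> set_power G B 2"
    using bc B(3)[OF bc(2)] set_power_add[OF B(1), of 1 1] by (auto simp: set_mult_def numeral_2_eq_2)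
  ultimately have "q \<in> set_power G B (2 + 2)"
    using set_power_diff[OF B(1) pq(2) p(1), of 2] by simp
  then show False using q(2) by simp
qed

section \<open>From the partition to the subgroup\<close>

lemma quot_set_subset: "A \<subseteq> carrier G \<Longrightarrow> quot_set A \<subseteq> carrier G"
  by (auto simp: quot_set_iff subset_iff)

lemma one_in_quot_set: "\<lbrakk>A \<subseteq> carrier G; A \<noteq> {}\<rbrakk> \<Longrightarrow> \<one> \<in> quot_set A"
  by (force simp: quot_set_iff)

text \<open>If g is outside A inv(A), then g A misses \<open>A\<close> and so lies in
  \<open>C\<close>. Hence for every y, either y or g y is in \<open>C\<close>; a fixed c in
  \<open>C\<close> then yields the two translates.\<close>

lemma two_cells_cover:
  assumes un: "A \<union> C = carrier G" and A: "quot_set A \<noteq> carrier G"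
  obtains g where "g \<in> carrier G" "C \<noteq> {}"
    "\<And>x. x \<in> carrier G \<Longrightarrow> x \<in> quot_set C \<or> (\<exists>b\<in>quot_set C. x = b \<otimes> g)"
proof -
  have sub: "A \<subseteq> carrier G" "C \<subseteq> carrier G" using un by auto
  obtain g where g: "g \<in> carrier G" "g \<notin> quot_set A" using A quot_set_subset[OF sub(1)] by blast
  have shift: "g \<otimes> a \<in> C" if a: "a \<in> A" for a
  proof (rule ccontr)
    assume "g \<otimes> a \<notin> C"
    then have "g \<otimes> a \<in> A" using g a sub un by blast
    moreover have "g = (g \<otimes> a) \<otimes> inv a" using g a sub by (simp add: m_assoc subset_iff)
    ultimately show False using g a by (metis quot_set_iff)
  qed
  have C: "C \<noteq> {}" using shift un one_closed by blast
  then obtain c where c: "c \<in> C" "c \<in> carrier G" using sub by blast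
  have "x \<in> quot_set C \<or> (\<exists>b\<in>quot_set C. x = b \<otimes> g)" if x: "x \<in> carrier G" for x
  proof -
    define y where "y = inv x \<otimes> c"
    have y: "y \<in> carrier G" using x c by (simp add: y_def)
    have xy: "x = c \<otimes> inv y" using x c by (simp add: y_def inv_mult_group m_assoc[symmetric])
    show ?thesis
    proof (cases "y \<in> C")
      case True
      then show ?thesis using xy c by (metis quot_set_iff)
    next
      case False
      then have "g \<otimes> y \<in> C" using shift y un by blast
      then have "c \<otimes> inv (g \<otimes> y) \<in> quot_set C" using c by (metis quot_set_iff)
      moreover have "x = (c \<otimes> inv (g \<otimes> y)) \<otimes> g"
        using xy c g y by (simp add: inv_mult_group m_assoc)
      ultimately show ?thesis by blast
    qed
  qed
  then show thesis using that g C by blast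
qed

lemma partition_quot_set_power:
  fixes A :: "nat \<Rightarrow> 'a set"
  assumes "disjoint_family_on A {1..n}" and "(\<Union>i\<in>{1..n}. A i) = carrier G"
  shows "\<exists>i\<in>{1..n}. subgroup_of_index_le G (set_power G (quot_set (A i)) (4 ^ (n - 1))) n"
proof -
  have sub: "A i \<subseteq> carrier G" if "i \<in> {1..n}" for i using assms(2) that by blast
  have n: "n \<noteq> 0"
  proof
    assume "n = 0"
    then show False using assms(2) one_closed by simp
  qed
  \<comment> \<open>Powers increase with the exponent, so a cover by translates of a smaller power
    \<open>k\<close> also bounds the index of the subgroup.\<close>
  have index_le: "subgroup_of_index_le G (set_power G (quot_set (A i)) (4 ^ (n - 1))) n"
    if i: "i \<in> {1..n}" "A i \<noteq> {}" and E: "finite E" "E \<subseteq> carrier G" "card E \<le> n"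
      and k: "k \<le> 4 ^ (n - 1)"
      and cover: "\<And>x. x \<in> carrier G \<Longrightarrow> \<exists>b\<in>set_power G (quot_set (A i)) k. \<exists>e\<in>E. x = b \<otimes> e"
      and stable: "set_power G (quot_set (A i)) (Suc (4 ^ (n - 1))) = set_power G (quot_set (A i)) (4 ^ (n - 1))"
    for i k E
  proof (rule subgroup_index_le_of_cover[OF _ E])
    note B = quot_set_subset[OF sub[OF i(1)]] one_in_quot_set[OF sub[OF i(1)] i(2)]
    show "subgroup (set_power G (quot_set (A i)) (4 ^ (n - 1))) G"
      by (rule stable_set_power_subgroup[OF B quot_set_inv[OF sub[OF i(1)]] stable])
    show "\<exists>h\<in>set_power G (quot_set (A i)) (4 ^ (n - 1)). \<exists>e\<in>E. x = h \<otimes> e" if "x \<in> carrier G" for x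
      using cover[OF that] set_power_mono[OF B k] by blast
  qed
  \<comment> \<open>Here every positive power is the whole group, a subgroup of index 1.\<close>
  have full: ?thesis if i: "i \<in> {1..n}" and full: "quot_set (A i) = carrier G" for i
  proof -
    have ne: "A i \<noteq> {}" using full one_closed by (auto simp: quot_set_iff)
    have le: "carrier G \<subseteq> set_power G (quot_set (A i)) k" if "1 \<le> k" for k
      using set_power_mono[of "quot_set (A i)" 1 k] full that by auto
    have eq: "set_power G (quot_set (A i)) k = carrier G" if "1 \<le> k" for k
      using le[OF that] set_power_subset[of "quot_set (A i)" k] full by auto
    have "subgroup_of_index_le G (set_power G (quot_set (A i)) (4 ^ (n - 1))) n"
      using n by (intro index_le[OF i ne, where E = "{\<one>}" and k = 1]) (auto simp: full eq[unfolded full] simp del: set_power.simps(3))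
    then show ?thesis using i by blast
  qed
  \<comment> \<open>The general stabilisation bound 5n - 1 <= 4^(n-1) fails for n = 1 and n = 2, so
    these cases are treated directly.\<close>
  consider "n = 1" | "n = 2" | "3 \<le> n" using n by linarith
  then show ?thesis
  proof cases
    case 1
    then have "quot_set (A 1) = carrier G"
      using assms(2) quot_set_subset[of "A 1"] by (force simp: quot_set_iff)
    then show ?thesis using full[of 1] 1 by simp
  next
    case 2
    show ?thesis
    proof (cases "quot_set (A 1) = carrier G")
      case True
      then show ?thesis using full[of 1] 2 by simp
    next
      case False
      have "A 1 \<union> A 2 = carrier G"
        using assms(2) 2 by (simp add: atLeastAtMostSuc_conv numeral_2_eq_2 Un_commute)
      then obtain g where g: "g \<in> carrier G" "A 2 \<noteq> {}"
        and cover: "\<And>x. x \<in> carrier G \<Longrightarrow> x \<in> quot_set (A 2) \<or> (\<exists>b\<in>quot_set (A 2). x = b \<otimes> g)"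
        using two_cells_cover[OF _ False] by blast
      have i: "2 \<in> {1..n}" using 2 by simp
      note B = quot_set_subset[OF sub[OF i]] one_in_quot_set[OF sub[OF i] g(2)]
      have "subgroup_of_index_le G (set_power G (quot_set (A 2)) (4 ^ (n - 1))) n"
      proof (rule index_le[OF i g(2), where E = "{\<one>, g}" and k = 1])
        show "card {\<one>, g} \<le> n" using 2 card_insert_le_m1[of 2 "{g}" \<one>] by simp
        show "\<exists>b\<in>set_power G (quot_set (A 2)) 1. \<exists>e\<in>{\<one>, g}. x = b \<otimes> e" if "x \<in> carrier G" for x
          using cover[OF that] that by (metis One_nat_def insertCI r_one set_power.simps(2))
        \<comment> \<open>For n = 2 the required exponent is exactly 4, where two translates force
          stability.\<close>
        show "set_power G (quot_set (A 2)) (Suc (4 ^ (n - 1))) = set_power G (quot_set (A 2)) (4 ^ (n - 1))"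
          using set_power_stable_of_two_translates[OF B quot_set_inv[OF sub[OF i]] g(1) cover] 2
          by (simp del: set_power.simps)
      qed (use g in auto)
      then show ?thesis using i by blast
    qed
  next
    case 3
    obtain i E where i: "i \<in> {1..n}" "A i \<noteq> {}" and E: "finite E" "E \<subseteq> carrier G" "card E \<le> n"
      and cover: "\<And>x. x \<in> carrier G \<Longrightarrow>
        \<exists>b\<in>quot_set (A i). \<exists>c\<in>quot_set (A i). \<exists>e\<in>E. x = b \<otimes> c \<otimes> e"
      using partition_cell_cover[OF assms] by blast
    note B = quot_set_subset[OF sub[OF i(1)]] one_in_quot_set[OF sub[OF i(1)] i(2)]
    have cover2: "\<exists>b\<in>set_power G (quot_set (A i)) 2. \<exists>e\<in>E. x = b \<otimes> e" if "x \<in> carrier G" for x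
      using cover[OF that] unfolding numeral_2_eq_2 by (fastforce simp: set_mult_def)
    \<comment> \<open>The induction starts with 15 <= 17 at n = 3.\<close>
    have large: "5 * n \<le> Suc (4 ^ (n - 1))"
      using 3
    proof (induction n rule: dec_induct)
      case (step m)
      then have "(4::nat) ^ m = 4 * 4 ^ (m - 1)" by (cases m) auto
      then show ?case using step by simp
    qed simp
    have "subgroup_of_index_le G (set_power G (quot_set (A i)) (4 ^ (n - 1))) n"
    proof (rule index_le[OF i E _ cover2])
      show "2 \<le> (4::nat) ^ (n - 1)" using large 3 by linarith
      show "set_power G (quot_set (A i)) (Suc (4 ^ (n - 1))) = set_power G (quot_set (A i)) (4 ^ (n - 1))"
        by (rule set_power_stable_of_cover[OF B quot_set_inv[OF sub[OF i(1)]] E cover2 large])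
    qed
    then show ?thesis using i by blast
  qed
qed

end

theorem corollary8p14:
  fixes G :: "('a, 'b) monoid_scheme" and A :: "nat \<Rightarrow> 'a set" and n :: nat
  assumes "group G"
    and "disjoint_family_on A {1..n}"
    and "(\<Union>i\<in>{1..n}. A i) = carrier G"
  shows "\<exists>i\<in>{1..n}.
    subgroup_of_index_le G
      (set_power G (A i <#>\<^bsub>G\<^esub> set_inv\<^bsub>G\<^esub> (A i)) (4 ^ (n - 1))) n"
  using group.partition_quot_set_power[OF assms] by (simp add: group.quot_set_def[OF assms(1)])

end
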